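(* Let $\mathcal{C}\subset\mathbb{R}^n$ be $\alpha$-prox-regular for some $\alpha>0$, and let $x\in\mathcal{C}+\frac{1}{2\alpha}\operatorname{int}\mathbb{B}$ and $v\in\mathbb{R}^n$ be such that the directional derivative $\overline{v}:=DP_{\mathcal{C}}(x;v)$ exists. Then $\langle v,\overline{v}\rangle\ge0$.
   Context: $\mathbb{R}^n$ carries the usual inner product and 2-norm; $\operatorname{int}\mathbb{B}$ is the open unit ball. $P_{\mathcal{C}}(x)$ is the set of points of $\mathcal{C}$ at minimal Euclidean distance from $x$. $T_x\mathcal{C}$ is the (Bouligand) tangent cone of $\mathcal{C}$ at $x\in\mathcal{C}$. $\mathcal{C}$ is Clarke regular if it is closed and $x\mapsto T_x\mathcal{C}$ is inner semicontinuous; then $N_x\mathcal{C}$ denotes the normal cone, i.e., the polar cone of $T_x\mathcal{C}$. Given $\alpha>0$, a Clarke regular set $\mathcal{C}$ is $\alpha$-prox-regular if for every $x\in\mathcal{C}$ and every $\eta\in N_x\mathcal{C}$ one has $\langle\eta,y-x\rangle\le\alpha\|\eta\|\|y-x\|^2$ for all $y\in\mathcal{C}$. It is known that then $P_{\mathcal{C}}$ is single-valued on the open set $\mathcal{C}+\frac{1}{2\alpha}\operatorname{int}\mathbb{B}$. The directional derivative is $DP_{\mathcal{C}}(x;v):=\lim_{h\to0^+}\frac{P_{\mathcal{C}}(x+hv)-P_{\mathcal{C}}(x)}{h}$. *)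

theory Defs
  imports "HOL-Analysis.Analysis"
begin

definition metric_proj :: "'a::metric_space set \<Rightarrow> 'a \<Rightarrow> 'a set" where
  "metric_proj C x = {p \<in> C. \<forall>y\<in>C. dist x p \<le> dist x y}"

definition tangent_cone :: "'a::real_normed_vector set \<Rightarrow> 'a \<Rightarrow> 'a set" where
  "tangent_cone C x = {v. \<exists>(X :: nat \<Rightarrow> 'a) (t :: nat \<Rightarrow> real).
      (\<forall>k. X k \<in> C \<and> t k > 0) \<and> X \<longlonglongrightarrow> x \<and> t \<longlonglongrightarrow> 0 \<and>
      (\<lambda>k. (X k - x) /\<^sub>R t k) \<longlonglongrightarrow> v}"

definition polar_cone :: "'a::real_inner set \<Rightarrow> 'a set" where
  "polar_cone K = {\<eta>. \<forall>v\<in>K. inner \<eta> v \<le> 0}"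

text \<open>Inner semicontinuity of a set-valued map relative to its domain \<open>S\<close>: at every
  \<open>x \<in> S\<close>, the set \<open>F x\<close> is contained in the inner limit of \<open>F y\<close> as \<open>y \<rightarrow> x\<close> in \<open>S\<close>.
  Selections are only required from some index on, since values of \<open>F\<close> may be empty in general.\<close>

definition inner_semicontinuous_on ::
    "'a::topological_space set \<Rightarrow> ('a \<Rightarrow> 'b::topological_space set) \<Rightarrow> bool" where
  "inner_semicontinuous_on S F \<longleftrightarrow>
     (\<forall>x\<in>S. \<forall>v\<in>F x. \<forall>X :: nat \<Rightarrow> 'a. (\<forall>k. X k \<in> S) \<and> X \<longlonglongrightarrow> x \<longrightarrow>
        (\<exists>V :: nat \<Rightarrow> 'b. (\<forall>\<^sub>F k in sequentially. V k \<in> F (X k)) \<and> V \<longlonglongrightarrow> v))"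

definition clarke_regular :: "'a::real_normed_vector set \<Rightarrow> bool" where
  "clarke_regular C \<longleftrightarrow> closed C \<and> inner_semicontinuous_on C (tangent_cone C)"

definition normal_cone :: "'a::real_inner set \<Rightarrow> 'a \<Rightarrow> 'a set" where
  "normal_cone C x = polar_cone (tangent_cone C x)"

definition prox_regular :: "real \<Rightarrow> 'a::real_inner set \<Rightarrow> bool" where
  "prox_regular \<alpha> C \<longleftrightarrow> clarke_regular C \<and>
     (\<forall>x\<in>C. \<forall>\<eta>\<in>normal_cone C x. \<forall>y\<in>C.
        inner \<eta> (y - x) \<le> \<alpha> * norm \<eta> * (norm (y - x))\<^sup>2)"

definition has_directional_derivative ::
    "('a::real_normed_vector \<Rightarrow> 'b::real_normed_vector) \<Rightarrow> 'a \<Rightarrow> 'a \<Rightarrow> 'b \<Rightarrow> bool" where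
  "has_directional_derivative f x v d \<longleftrightarrow>
     ((\<lambda>h::real. (f (x + h *\<^sub>R v) - f x) /\<^sub>R h) \<longlongrightarrow> d) (at_right 0)"

text \<open>The projection as a point-valued map. It is meaningful only where \<open>metric_proj C x\<close> is a
  singleton. For \<open>\<alpha>\<close>-prox-regular \<open>C\<close> this holds on the open set \<open>C + 1/(2\<alpha>) int B\<close>, which
  contains \<open>x + h v\<close> for all small \<open>h\<close> whenever it contains \<open>x\<close>; the values elsewhere do not
  affect directional derivatives at its points.\<close>

definition proj_point :: "'a::metric_space set \<Rightarrow> 'a \<Rightarrow> 'a" where
  "proj_point C x = the_elem (metric_proj C x)"

end

theory Submission
  imports Defs
begin

text \<open>Comparing the two minimality conditions shows that a metric projection is a monotone map, so
  every difference quotient of the projection along \<open>v\<close> has nonnegative inner product with \<open>v\<close>.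
  Prox-regularity only serves to make the projection single-valued near \<open>x\<close>.\<close>

lemma metric_proj_monotone:
  fixes C :: "'a::real_inner set"
  assumes "p \<in> metric_proj C x" "q \<in> metric_proj C y"
  shows "inner (y - x) (q - p) \<ge> 0"
proof -
  have "(dist x p)\<^sup>2 + (dist y q)\<^sup>2 \<le> (dist x q)\<^sup>2 + (dist y p)\<^sup>2"
    using assms by (intro add_mono power_mono) (simp_all add: metric_proj_def)
  \<comment> \<open>After expansion the four squared norms cancel in pairs; the mixed terms leave
    twice the claimed inner product.\<close>
  then show ?thesis
    by (simp add: dist_norm power2_norm_eq_inner inner_diff_left inner_diff_right
        inner_commute)
qed

text \<open>The law of cosines centred at \<open>p\<close>. It turns a comparison of distances from
  \<open>x\<close> into information on the inner product with \<open>x - p\<close>.\<close>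

lemma dist_square_expand:
  fixes x p y :: "'a::real_inner"
  shows "(dist x y)\<^sup>2 = (dist x p)\<^sup>2 - 2 * inner (x - p) (y - p) + (norm (y - p))\<^sup>2"
  by (simp add: dist_norm power2_norm_eq_inner inner_diff_left inner_diff_right inner_commute)

text \<open>Minimality bounds the inner product of \<open>x - p\<close> with a displacement inside
  \<open>C\<close> by a term quadratic in that displacement, which vanishes to first order along
  tangent directions. This makes \<open>x - p\<close> an admissible normal in the prox-regularity
  inequality.\<close>

lemma metric_proj_normal:
  fixes C :: "'a::real_inner set"
  assumes p: "p \<in> metric_proj C x"
  shows "x - p \<in> normal_cone C p"
  unfolding normal_cone_def polar_cone_def mem_Collect_eq
proof
  fix d assume "d \<in> tangent_cone C p"
  then obtain X :: "nat \<Rightarrow> 'a" and t :: "nat \<Rightarrow> real" where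
    XC: "\<And>k. X k \<in> C" and t: "\<And>k. t k > 0" and X: "X \<longlonglongrightarrow> p"
    and d: "(\<lambda>k. (X k - p) /\<^sub>R t k) \<longlonglongrightarrow> d"
    unfolding tangent_cone_def by blast
  \<comment> \<open>Of the two factors \<open>norm (X k - p)\<close> only one is divided by
    \<open>t k\<close>; the other tends to 0 and kills the right-hand side in the limit.\<close>
  have "2 * inner (x - p) ((X k - p) /\<^sub>R t k) \<le> norm (X k - p) * norm ((X k - p) /\<^sub>R t k)" for k
  proof -
    have "(dist x p)\<^sup>2 \<le> (dist x (X k))\<^sup>2"
      using p XC by (intro power_mono) (simp_all add: metric_proj_def)
    then have "2 * inner (x - p) (X k - p) \<le> (norm (X k - p))\<^sup>2"
      using dist_square_expand[of x "X k" p] by simp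
    then have "2 * inner (x - p) (X k - p) / t k \<le> (norm (X k - p))\<^sup>2 / t k"
      using t[of k] by (intro divide_right_mono) auto
    then show ?thesis
      using t[of k] by (simp add: divide_inverse power2_eq_square mult_ac)
  qed
  moreover have "(\<lambda>k. 2 * inner (x - p) ((X k - p) /\<^sub>R t k)) \<longlonglongrightarrow> 2 * inner (x - p) d"
    by (intro tendsto_intros d)
  moreover have "(\<lambda>k. norm (X k - p) * norm ((X k - p) /\<^sub>R t k)) \<longlonglongrightarrow> norm (p - p) * norm d"
    by (intro tendsto_intros d X)
  ultimately have "2 * inner (x - p) d \<le> norm (p - p) * norm d"
    by (meson LIMSEQ_le)
  then show "inner (x - p) d \<le> 0" by simp
qed

text \<open>For two equidistant nearest points the law of cosines has only its last two terms left.
  Prox-regularity with normal \<open>x - p\<close> then bounds the squared gap by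
  \<open>2 * \<alpha> * norm (x - p)\<close> times itself, and this factor is below 1. The point
  \<open>c\<close> only certifies that \<open>x\<close> is close enough to \<open>C\<close>.\<close>

lemma metric_proj_unique:
  fixes C :: "'a::real_inner set"
  assumes "\<alpha> > 0" and prox: "prox_regular \<alpha> C"
    and p: "p \<in> metric_proj C x" and q: "q \<in> metric_proj C x"
    and c: "c \<in> C" "dist x c < 1 / (2 * \<alpha>)"
  shows "q = p"
proof (rule ccontr)
  assume "q \<noteq> p"
  then have pos: "(norm (q - p))\<^sup>2 > 0" by simp
  have "p \<in> C" "q \<in> C" and eq: "dist x q = dist x p"
    using p q by (auto simp: metric_proj_def intro!: order_antisym)
  have "dist x p \<le> dist x c"
    using p c by (simp add: metric_proj_def)
  then have "norm (x - p) < 1 / (2 * \<alpha>)"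
    using c by (simp add: dist_norm)
  then have lt: "2 * \<alpha> * norm (x - p) < 1"
    using \<open>\<alpha> > 0\<close> by (simp add: field_simps)
  have "(norm (q - p))\<^sup>2 = 2 * inner (x - p) (q - p)"
    using dist_square_expand[of x q p] eq by simp
  also have "\<dots> \<le> 2 * (\<alpha> * norm (x - p) * (norm (q - p))\<^sup>2)"
    using prox metric_proj_normal[OF p] \<open>p \<in> C\<close> \<open>q \<in> C\<close> by (auto simp: prox_regular_def)
  also have "\<dots> < (norm (q - p))\<^sup>2"
    using mult_strict_right_mono[OF lt pos] by (simp add: mult.assoc)
  finally show False by simp
qed

text \<open>\<open>the_elem\<close> is informative only on singletons: closedness in finite
  dimension gives a nearest point, and the bound on \<open>dist x c\<close> gives its
  uniqueness.\<close>

lemma proj_point_mem: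
  fixes C :: "'a::euclidean_space set"
  assumes "\<alpha> > 0" "prox_regular \<alpha> C" "c \<in> C" "dist x c < 1 / (2 * \<alpha>)"
  shows "proj_point C x \<in> metric_proj C x"
proof -
  have "closed C" using assms by (simp add: prox_regular_def clarke_regular_def)
  then obtain p where "p \<in> C" "\<And>y. y \<in> C \<Longrightarrow> dist x p \<le> dist x y"
    using distance_attains_inf[of C x] assms(3) by (metis empty_iff)
  then have p: "p \<in> metric_proj C x" by (simp add: metric_proj_def)
  have "q = p" if "q \<in> metric_proj C x" for q
    by (rule metric_proj_unique[OF assms(1,2) p that assms(3,4)])
  with p have "metric_proj C x = {p}" by blast
  then show ?thesis using p by (simp add: proj_point_def)
qed

theorem lemma6:
  fixes C :: "(real ^ 'n) set" and x v v_bar :: "real ^ 'n" and \<alpha> :: real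
  assumes "\<alpha> > 0"
    and "prox_regular \<alpha> C"
    and "x \<in> {c + (1 / (2 * \<alpha>)) *\<^sub>R b | c b. c \<in> C \<and> b \<in> ball 0 1}"
    and "has_directional_derivative (proj_point C) x v v_bar"
  shows "inner v v_bar \<ge> 0"
proof -
  obtain c b where c: "c \<in> C" and x: "x = c + (1 / (2 * \<alpha>)) *\<^sub>R b" and b: "norm b < 1"
    using assms(3) by auto
  have xc: "dist x c < 1 / (2 * \<alpha>)"
    using b \<open>\<alpha> > 0\<close> by (simp add: x dist_norm field_simps)
  \<comment> \<open>By continuity the same \<open>c\<close> certifies closeness to \<open>C\<close>
    for every \<open>x + h *\<^sub>R v\<close> with small \<open>h\<close>.\<close>
  have "((\<lambda>h. dist (x + h *\<^sub>R v) c) \<longlongrightarrow> dist (x + 0 *\<^sub>R v) c) (at_right 0)"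
    by (intro tendsto_intros)
  then have "\<forall>\<^sub>F h in at_right 0. dist (x + h *\<^sub>R v) c < 1 / (2 * \<alpha>)"
    using xc by (auto dest: order_tendstoD(2))
  moreover have "\<forall>\<^sub>F h::real in at_right 0. h > 0"
    by (rule eventually_at_right_less)
  ultimately have "\<forall>\<^sub>F h in at_right 0.
      0 \<le> inner v ((proj_point C (x + h *\<^sub>R v) - proj_point C x) /\<^sub>R h)"
  proof eventually_elim
    case (elim h)
    have "0 \<le> inner (x + h *\<^sub>R v - x) (proj_point C (x + h *\<^sub>R v) - proj_point C x)"
      by (intro metric_proj_monotone[where C = C] proj_point_mem[OF assms(1,2) c] xc elim)
    \<comment> \<open>The displacement is \<open>h *\<^sub>R v\<close>, so the positive factor
      \<open>h\<close> can be removed without changing the sign.\<close>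
    then show ?case using elim by (simp add: zero_le_mult_iff)
  qed
  moreover have "((\<lambda>h. inner v ((proj_point C (x + h *\<^sub>R v) - proj_point C x) /\<^sub>R h))
      \<longlongrightarrow> inner v v_bar) (at_right 0)"
    using assms(4) unfolding has_directional_derivative_def by (intro tendsto_intros)
  ultimately show ?thesis
    by (intro tendsto_lowerbound) auto
qed

end
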